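(* Let $h\geq 1$ and $1\leq d\leq h$. Let $L_h$ denote the polyomino of width $2$ whose left column consists of $h$ cells and whose right column consists of a single cell adjacent to the bottom cell of the left column. For $n\geq 0$ let \[ P_{d,n}(t)=\sum_{T} t^{\mathrm{bigtiles}(T)}, \] where $T$ ranges over all tilings of the board with $h+d-1$ rows and $n$ columns by unit squares and translates of $L_h$, and $\mathrm{bigtiles}(T)$ is the number of copies of $L_h$ used in $T$. Set $P_{d,m}(t)=0$ for $m<0$. Then $P_{d,0}(t)=1$ and for all $n\geq 0$, \[ P_{d,n+1}(t)=\sum_{k=0}^{d}\binom{d}{k}t^k\,P_{d,n-k}(t). \] In particular this recursion does not depend on $h$ as long as $h\geq d$. *)

theory Defs
  imports "HOL-Library.Disjoint_Sets" "HOL-Computational_Algebra.Polynomial"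
begin

text \<open>A cell is a pair \<open>(column, row)\<close>; rows are numbered from bottom to top.\<close>

type_synonym cell = "int \<times> int"

definition translates :: "cell set \<Rightarrow> cell set set" where
  "translates S = {(\<lambda>(x, y). (x + a, y + b)) ` S | a b. True}"

definition L_shape :: "nat \<Rightarrow> cell set" where
  "L_shape h = {0} \<times> {0..<int h} \<union> {(1, 0)}"

definition board :: "nat \<Rightarrow> nat \<Rightarrow> cell set" where
  "board r n = {0..<int n} \<times> {0..<int r}"

text \<open>For \<open>h \<ge> 1\<close> a copy of \<open>L_shape h\<close> has at least two cells, so identifying a tile with its
  set of cells never confuses it with a unit square.\<close>

definition tilings :: "nat \<Rightarrow> cell set \<Rightarrow> cell set set set" where
  "tilings h B = {T. partition_on B T \<and> T \<subseteq> translates {(0, 0)} \<union> translates (L_shape h)}"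

definition bigtiles :: "nat \<Rightarrow> cell set set \<Rightarrow> nat" where
  "bigtiles h T = card {A \<in> T. A \<in> translates (L_shape h)}"

text \<open>The sums below range over finite sets, and only count finitely many tiles.\<close>

lemma finite_tilings: "finite (tilings h (board r n))"
proof (rule finite_subset)
  show "tilings h (board r n) \<subseteq> Pow (Pow (board r n))"
    by (auto simp: tilings_def partition_on_def)
  show "finite (Pow (Pow (board r n)))"
    by (simp add: board_def)
qed

lemma finite_tiling: "T \<in> tilings h (board r n) \<Longrightarrow> finite T"
  by (rule finite_elements[of "board r n"]) (auto simp: tilings_def board_def)

text \<open>The index \<open>m\<close> (number of columns) is an integer, to allow for the convention that the
  polynomial is \<open>0\<close> when \<open>m < 0\<close>.  The indeterminate \<open>t\<close> is \<open>monom 1 1\<close>.\<close>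

definition tiling_poly :: "nat \<Rightarrow> nat \<Rightarrow> int \<Rightarrow> int poly" where
  "tiling_poly h d m =
     (if m < 0 then 0
      else \<Sum>T\<in>tilings h (board (h + d - 1) (nat m)). monom 1 1 ^ bigtiles h T)"

end

theory Submission imports Defs begin

text \<open>Since \<open>d \<le> h\<close>, every big tile meets row \<open>d - 1\<close> in its left column, so two big tiles never
  share a left column, and big tiles in neighbouring left columns are disjoint iff the left one
  sits strictly lower. Tilings thus correspond to choices, for each column but the last, of at
  most one height below \<open>d\<close>, increasing strictly along runs of consecutive columns. Classifying
  these by the bound \<open>e\<close> on the height in their last column gives Pascal's recursion in \<open>e\<close>.\<close>

section \<open>Big tiles named by the bottom cell of their left column; tilings as packings of big
  tiles\<close>

definition L_at :: "nat \<Rightarrow> cell \<Rightarrow> cell set" where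
  "L_at h p = {fst p} \<times> {snd p..<snd p + int h} \<union> {(fst p + 1, snd p)}"

definition placements :: "nat \<Rightarrow> cell set \<Rightarrow> cell set set" where
  "placements h B = {S. (\<forall>p\<in>S. L_at h p \<subseteq> B) \<and> disjoint_family_on (L_at h) S}"

lemma translates_singleton: "translates {(0, 0)} = range (\<lambda>c. {c})"
  by (auto simp: translates_def)

lemma translates_L_shape: "translates (L_shape h) = range (L_at h)"
proof -
  have "(\<lambda>(x, y). (x + a, y + b)) ` L_shape h = L_at h (a, b)" for a b
  proof -
    have "(\<lambda>(x, y). (x + a, y + b)) ` ({0} \<times> {0..<int h}) = {a} \<times> {b..<b + int h}"
    proof (intro equalityI subsetI)
      fix z assume "z \<in> {a} \<times> {b..<b + int h}"
      then show "z \<in> (\<lambda>(x, y). (x + a, y + b)) ` ({0} \<times> {0..<int h})"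
        by (intro image_eqI[of _ _ "(0, snd z - b)"]) auto
    qed auto
    then show ?thesis
      by (simp add: L_shape_def L_at_def image_Un add.commute)
  qed
  then show ?thesis
    unfolding translates_def by force
qed

lemma anchor_in_L_at: "1 \<le> h \<Longrightarrow> p \<in> L_at h p"
  by (cases p) (auto simp: L_at_def)

lemma foot_in_L_at: "(fst p + 1, snd p) \<in> L_at h p"
  by (simp add: L_at_def)

text \<open>If two equal tiles had different feet, each foot would lie in the left column of the
  other tile, so each column index would be the successor of the other. Hence the feet agree, and
  they determine \<open>p\<close> and \<open>q\<close>.\<close>

lemma inj_L_at:
  assumes "1 \<le> h"
  shows "inj (L_at h)"
proof (rule injI)
  fix p q assume eq: "L_at h p = L_at h q"
  have "(fst p + 1, snd p) \<in> L_at h q" "(fst q + 1, snd q) \<in> L_at h p"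
    using foot_in_L_at[of p h] foot_in_L_at[of q h] eq by simp_all
  then show "p = q"
    by (auto simp: L_at_def prod_eq_iff)
qed

lemma L_at_neq_singleton:
  assumes "1 \<le> h"
  shows "L_at h p \<noteq> {c}"
proof
  assume "L_at h p = {c}"
  with anchor_in_L_at[OF assms, of p] foot_in_L_at[of p h] show False
    by (metis fst_conv singletonD zless_add1_eq less_irrefl)
qed

lemma tilings_iff:
  "T \<in> tilings h B \<longleftrightarrow> partition_on B T \<and> (\<forall>A\<in>T. (\<exists>c. A = {c}) \<or> (\<exists>p. A = L_at h p))"
  unfolding tilings_def translates_singleton translates_L_shape by blast

lemma bigtiles_eq_card:
  assumes "1 \<le> h"
  shows "bigtiles h T = card {p. L_at h p \<in> T}"
proof -
  have "{A \<in> T. A \<in> translates (L_shape h)} = L_at h ` {p. L_at h p \<in> T}"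
    by (auto simp: translates_L_shape)
  then show ?thesis
    using inj_L_at[OF assms] by (simp add: bigtiles_def card_image inj_on_subset)
qed

text \<open>A tiling is determined by its big tiles, since every cell they leave uncovered must be a
  unit square; conversely any disjoint family of big tiles inside \<open>B\<close> can be completed
  this way. The witnesses \<open>i\<close> and \<open>j\<close> below are these two mutually inverse
  maps.\<close>

lemma sum_tilings_eq_sum_placements:
  assumes h: "1 \<le> h"
  shows "(\<Sum>T\<in>tilings h B. f (bigtiles h T)) = (\<Sum>S\<in>placements h B. f (card S))"
proof (rule sum.reindex_bij_witness[where
      i = "\<lambda>S. L_at h ` S \<union> (\<lambda>c. {c}) ` (B - \<Union> (L_at h ` S))" and j = "\<lambda>T. {p. L_at h p \<in> T}"])
  fix T assume "T \<in> tilings h B"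
  then have part: "partition_on B T"
    and shape: "\<And>A. A \<in> T \<Longrightarrow> (\<exists>c. A = {c}) \<or> (\<exists>p. A = L_at h p)"
    by (auto simp: tilings_iff)
  have U: "\<Union>T = B"
    using part by (simp add: partition_on_def)
  have same: "A = A'" if "A \<in> T" "A' \<in> T" "c \<in> A" "c \<in> A'" for A A' c
    using part that by (auto simp: partition_on_def disjoint_def)
  let ?S = "{p. L_at h p \<in> T}"
  show "L_at h ` ?S \<union> (\<lambda>c. {c}) ` (B - \<Union> (L_at h ` ?S)) = T" (is "?T = T")
  proof (intro equalityI subsetI)
    fix A assume "A \<in> ?T"
    then consider p where "L_at h p \<in> T" "A = L_at h p"
      | c where "c \<in> B" "\<And>p. L_at h p \<in> T \<Longrightarrow> c \<notin> L_at h p" "A = {c}"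
      by blast
    then show "A \<in> T"
    proof cases
      case 2
      \<comment> \<open>The tile \<open>A'\<close> covering \<open>c\<close> is not a big tile by
        the case assumption, so it must be the unit square \<open>{c}\<close>.\<close>
      then obtain A' where "A' \<in> T" "c \<in> A'" using U by blast
      with 2 shape[of A'] show ?thesis by auto
    qed simp
  next
    fix A assume A: "A \<in> T"
    from shape[OF this] consider c where "A = {c}" | p where "A = L_at h p" by blast
    then show "A \<in> ?T"
    proof cases
      case 1
      \<comment> \<open>A big tile through \<open>c\<close> would share \<open>c\<close> with the
        tile \<open>{c}\<close> and hence equal it, but big tiles are not singletons.\<close>
      have "c \<notin> L_at h p" if "L_at h p \<in> T" for p
        using same[OF that A, of c] L_at_neq_singleton[OF h, of p c] 1 by auto
      then show ?thesis using A 1 U by auto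
    qed (use A in auto)
  qed
  have "disjoint_family_on (L_at h) ?S"
    unfolding disjoint_family_on_def
  proof (intro ballI impI)
    fix p q assume "p \<in> ?S" "q \<in> ?S" "p \<noteq> q"
    then show "L_at h p \<inter> L_at h q = {}"
      using same[of "L_at h p" "L_at h q"] injD[OF inj_L_at[OF h], of p q] by auto
  qed
  then show "?S \<in> placements h B"
    using U by (auto simp: placements_def)
  show "f (card ?S) = f (bigtiles h T)"
    by (simp add: bigtiles_eq_card[OF h])
next
  fix S assume "S \<in> placements h B"
  then have sub: "\<And>p. p \<in> S \<Longrightarrow> L_at h p \<subseteq> B"
    and disj: "\<And>p q. p \<in> S \<Longrightarrow> q \<in> S \<Longrightarrow> p \<noteq> q \<Longrightarrow> L_at h p \<inter> L_at h q = {}"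
    by (auto simp: placements_def disjoint_family_on_def)
  let ?T = "L_at h ` S \<union> (\<lambda>c. {c}) ` (B - \<Union> (L_at h ` S))"
  show "{p. L_at h p \<in> ?T} = S"
    using injD[OF inj_L_at[OF h]] L_at_neq_singleton[OF h] by auto
  have "partition_on B ?T"
  proof (rule partition_onI)
    show "\<Union> ?T = B" using sub by auto
    show "{} \<notin> ?T" using anchor_in_L_at[OF h] by auto
    fix A A' assume "A \<in> ?T" "A' \<in> ?T" "A \<noteq> A'"
    then show "disjnt A A'"
      using disj unfolding disjnt_def by blast
  qed
  then show "?T \<in> tilings h B"
    by (auto simp: tilings_iff)
qed

section \<open>Packings on the rectangular board as profiles of heights\<close>

definition profiles :: "nat \<Rightarrow> nat \<Rightarrow> nat \<Rightarrow> cell set set" where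
  "profiles d m e = {S. S \<subseteq> {0..<int m} \<times> {0..<int d} \<and>
     (\<forall>x y x' y'. (x, y) \<in> S \<longrightarrow> (x', y') \<in> S \<longrightarrow> (x' = x \<longrightarrow> y' = y) \<and> (x' = x + 1 \<longrightarrow> y < y')) \<and>
     (\<forall>y. (int m - 1, y) \<in> S \<longrightarrow> y < int e)}"

text \<open>The bound \<open>e\<close> concerns only column \<open>m - 1\<close>: at
  \<open>e = d\<close> it is vacuous, at \<open>e = 0\<close> it forces that column to be empty.
  Letting it run between these extremes is what produces a recursion.\<close>

definition profile_poly :: "nat \<Rightarrow> nat \<Rightarrow> nat \<Rightarrow> int poly" where
  "profile_poly d m e = (\<Sum>S\<in>profiles d m e. monom 1 1 ^ card S)"

lemma finite_profile: "S \<in> profiles d m e \<Longrightarrow> finite S"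
  by (rule finite_subset[of _ "{0..<int m} \<times> {0..<int d}"]) (auto simp: profiles_def)

lemma finite_profiles: "finite (profiles d m e)"
  by (rule finite_subset[of _ "Pow ({0..<int m} \<times> {0..<int d})"]) (auto simp: profiles_def)

text \<open>The left column reaches up to \<open>y + h - 1\<close>, which must be at most
  \<open>h + d - 2\<close>, so \<open>y < d\<close>. The foot lies in column \<open>x + 1\<close>,
  so the last of the \<open>Suc m\<close> columns cannot be a left column.\<close>

lemma L_at_subset_board_iff:
  assumes "1 \<le> h" "1 \<le> d"
  shows "L_at h p \<subseteq> board (h + d - 1) (Suc m) \<longleftrightarrow> p \<in> {0..<int m} \<times> {0..<int d}"
proof (cases p, safe del: subsetI)
  fix x y
  assume sub: "L_at h (x, y) \<subseteq> board (h + d - 1) (Suc m)"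
  have "(x, y) \<in> L_at h (x, y)" "(x, y + int h - 1) \<in> L_at h (x, y)" "(x + 1, y) \<in> L_at h (x, y)"
    using assms by (auto simp: L_at_def)
  with sub have "(x, y) \<in> board (h + d - 1) (Suc m)" "(x + 1, y) \<in> board (h + d - 1) (Suc m)"
    "(x, y + int h - 1) \<in> board (h + d - 1) (Suc m)" by blast+
  then show "x \<in> {0..<int m}" "y \<in> {0..<int d}"
    using assms by (auto simp: board_def)
next
  fix x y
  assume "x \<in> {0..<int m}" "y \<in> {0..<int d}"
  then show "L_at h (x, y) \<subseteq> board (h + d - 1) (Suc m)"
    using assms by (auto simp: board_def L_at_def)
qed

text \<open>As both heights are below \<open>d \<le> h\<close>, two left columns in the same board
  column overlap. For neighbours, the foot of the left tile must avoid the left column of the right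
  tile; it cannot pass above it, because \<open>y < d \<le> h \<le> y' + h\<close>, so it must lie
  strictly below.\<close>

lemma disjoint_L_at_iff:
  assumes "1 \<le> h" "d \<le> h" "y \<in> {0..<int d}" "y' \<in> {0..<int d}"
  shows "L_at h (x, y) \<inter> L_at h (x', y') = {} \<longleftrightarrow>
    x' \<noteq> x \<and> (x' = x + 1 \<longrightarrow> y < y') \<and> (x = x' + 1 \<longrightarrow> y' < y)"
proof
  assume disj: "L_at h (x, y) \<inter> L_at h (x', y') = {}"
  \<comment> \<open>The cell at height \<open>max y y'\<close> is common when \<open>x = x'\<close>;
    the two conditional memberships place the foot of one tile inside the left column of the other
    when the columns are adjacent.\<close>
  have "(x, max y y') \<in> L_at h (x, y)" "(x', max y y') \<in> L_at h (x', y')"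
    "(x + 1, y) \<in> L_at h (x, y)" "(x' + 1, y') \<in> L_at h (x', y')"
    "y' \<le> y \<Longrightarrow> (x', y) \<in> L_at h (x', y')" "y \<le> y' \<Longrightarrow> (x, y') \<in> L_at h (x, y)"
    using assms by (auto simp: L_at_def max_def)
  with disj show "x' \<noteq> x \<and> (x' = x + 1 \<longrightarrow> y < y') \<and> (x = x' + 1 \<longrightarrow> y' < y)"
    by (metis disjoint_iff linorder_not_less)
next
  assume "x' \<noteq> x \<and> (x' = x + 1 \<longrightarrow> y < y') \<and> (x = x' + 1 \<longrightarrow> y' < y)"
  then show "L_at h (x, y) \<inter> L_at h (x', y') = {}"
    by (auto simp: L_at_def)
qed

lemma placements_board:
  assumes "1 \<le> h" "1 \<le> d" "d \<le> h"
  shows "placements h (board (h + d - 1) (Suc m)) = profiles d m d"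
proof (intro set_eqI)
  fix S
  have "S \<in> placements h (board (h + d - 1) (Suc m)) \<longleftrightarrow>
    S \<subseteq> {0..<int m} \<times> {0..<int d} \<and> disjoint_family_on (L_at h) S"
    unfolding placements_def L_at_subset_board_iff[OF assms(1,2)] by blast
  also have "\<dots> \<longleftrightarrow> S \<in> profiles d m d"
  proof (cases "S \<subseteq> {0..<int m} \<times> {0..<int d}")
    case True
    then have y: "y \<in> {0..<int d}" if "(x, y) \<in> S" for x y
      using that by auto
    note disjoint_iff = disjoint_L_at_iff[OF assms(1,3) y y]
    show ?thesis
    proof
      assume *: "S \<subseteq> {0..<int m} \<times> {0..<int d} \<and> disjoint_family_on (L_at h) S"
      have "(x' = x \<longrightarrow> y' = y) \<and> (x' = x + 1 \<longrightarrow> y < y')" if S: "(x, y) \<in> S" "(x', y') \<in> S" for x y x' y'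
      proof (cases "(x, y) = (x', y')")
        case False
        then have "L_at h (x, y) \<inter> L_at h (x', y') = {}"
          using * S unfolding disjoint_family_on_def by blast
        then show ?thesis
          using disjoint_iff[OF S] by simp
      qed simp
      then show "S \<in> profiles d m d"
        using True y by (auto simp: profiles_def)
    next
      assume S: "S \<in> profiles d m d"
      have "L_at h p \<inter> L_at h q = {}" if pq: "p \<in> S" "q \<in> S" "p \<noteq> q" for p q
      proof -
        obtain x y x' y' where [simp]: "p = (x, y)" "q = (x', y')"
          by (metis surj_pair)
        \<comment> \<open>The third conjunct is the profile condition with the two points
          exchanged.\<close>
        have "(x' = x \<longrightarrow> y' = y) \<and> (x' = x + 1 \<longrightarrow> y < y') \<and> (x = x' + 1 \<longrightarrow> y' < y)"
          using S pq(1,2) by (simp add: profiles_def)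
        then show ?thesis
          using disjoint_iff[of x y x' y'] pq by auto
      qed
      then show "S \<subseteq> {0..<int m} \<times> {0..<int d} \<and> disjoint_family_on (L_at h) S"
        using True by (auto simp: disjoint_family_on_def)
    qed
  qed (auto simp: profiles_def)
  finally show "S \<in> placements h (board (h + d - 1) (Suc m)) \<longleftrightarrow> S \<in> profiles d m d" .
qed

lemma tiling_poly_Suc:
  assumes "1 \<le> h" "1 \<le> d" "d \<le> h"
  shows "tiling_poly h d (int (Suc m)) = profile_poly d m d"
  unfolding tiling_poly_def profile_poly_def
  using sum_tilings_eq_sum_placements[OF assms(1), of "\<lambda>k. monom (1::int) 1 ^ k"]
  by (simp del: of_nat_Suc One_nat_def add: placements_board[OF assms])

lemma tiling_poly_0: "tiling_poly h d 0 = 1"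
proof -
  have "tilings h (board r 0) = {{}}" for r
    by (auto simp: tilings_def board_def partition_on_def)
  then show ?thesis
    by (simp add: tiling_poly_def bigtiles_def)
qed

lemma tiling_poly_neg: "m < 0 \<Longrightarrow> tiling_poly h d m = 0"
  by (simp add: tiling_poly_def)

section \<open>Pascal recursion in the bound on the last column\<close>

lemma profile_poly_no_columns: "profile_poly d 0 e = 1"
proof -
  have "profiles d 0 e = {{}}"
    by (auto simp: profiles_def)
  then show ?thesis
    by (simp add: profile_poly_def)
qed

text \<open>Column \<open>m\<close> must stay empty, and an empty neighbour imposes nothing on
  column \<open>m - 1\<close>, whose heights are then bounded by \<open>d\<close> only.\<close>

lemma profile_poly_empty_last: "profile_poly d (Suc m) 0 = profile_poly d m d"
proof -
  have "profiles d (Suc m) 0 = profiles d m d"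
  proof (intro equalityI subsetI)
    fix S assume S: "S \<in> profiles d (Suc m) 0"
    have lt: "x < int m" if "(x, y) \<in> S" for x y
    proof (rule ccontr)
      assume "\<not> x < int m"
      with S that have "x = int m" by (force simp: profiles_def)
      with S that show False by (force simp: profiles_def)
    qed
    have "S \<subseteq> {0..<int m} \<times> {0..<int d}"
      using S lt by (simp add: profiles_def subset_iff)
    then show "S \<in> profiles d m d"
      using S by (auto simp: profiles_def)
  next
    fix S assume "S \<in> profiles d m d"
    then show "S \<in> profiles d (Suc m) 0"
      by (fastforce simp: profiles_def subset_iff)
  qed
  then show ?thesis
    by (simp add: profile_poly_def)
qed

text \<open>The bound \<open>e\<close> on column \<open>m - 1\<close> is exactly what makes the step
  up to height \<open>e\<close> in column \<open>m\<close> strict.\<close>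

lemma insert_in_profiles:
  assumes "e < d" "S \<in> profiles d m e"
  shows "insert (int m, int e) S \<in> profiles d (Suc m) (Suc e)"
proof -
  have range: "0 \<le> x \<and> x < int m \<and> 0 \<le> y \<and> y < int d" if "(x, y) \<in> S" for x y
    using assms(2) that by (auto simp: profiles_def)
  have last: "y < int e" if "(x, y) \<in> S" "int m = x + 1" for x y
  proof -
    from that have "(int m - 1, y) \<in> S" by simp
    with assms(2) show ?thesis by (simp add: profiles_def)
  qed
  have "(x' = x \<longrightarrow> y' = y) \<and> (x' = x + 1 \<longrightarrow> y < y')"
    if mem: "(x, y) \<in> insert (int m, int e) S" "(x', y') \<in> insert (int m, int e) S" for x y x' y'
  proof -
    consider "(x, y) \<in> S" "(x', y') \<in> S" | "(x, y) = (int m, int e)" "(x', y') \<in> S"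
      | "(x, y) \<in> S" "(x', y') = (int m, int e)" | "(x, y) = (int m, int e)" "(x', y') = (int m, int e)"
      using mem by blast
    then show ?thesis
    proof cases
      case 1
      with assms(2) show ?thesis by (simp add: profiles_def)
    next
      case 2
      with range[of x' y'] show ?thesis by auto
    next
      case 3
      with range[of x y] last[of x y] show ?thesis by auto
    qed auto
  qed
  moreover have "insert (int m, int e) S \<subseteq> {0..<int (Suc m)} \<times> {0..<int d}"
    using range assms(1) by (auto dest!: range)
  moreover have "y < int (Suc e)" if "(int m, y) \<in> insert (int m, int e) S" for y
    using that range[of "int m" y] by auto
  ultimately show ?thesis
    by (simp add: profiles_def)
qed

text \<open>The removed point is the only one in column \<open>m\<close>, and by strict increase it
  keeps the heights in column \<open>m - 1\<close> below \<open>e\<close>.\<close>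

lemma remove_from_profiles:
  assumes S: "S \<in> profiles d (Suc m) (Suc e)" and mem: "(int m, int e) \<in> S"
  shows "S - {(int m, int e)} \<in> profiles d m e"
proof -
  have sub: "S \<subseteq> {0..<int (Suc m)} \<times> {0..<int d}"
    and eq: "\<And>x y y'. (x, y) \<in> S \<Longrightarrow> (x, y') \<in> S \<Longrightarrow> y' = y"
    and less: "\<And>x y y'. (x, y) \<in> S \<Longrightarrow> (x + 1, y') \<in> S \<Longrightarrow> y < y'"
    using S by (auto simp: profiles_def)
  have "S - {(int m, int e)} \<subseteq> {0..<int m} \<times> {0..<int d}"
  proof
    fix z assume z: "z \<in> S - {(int m, int e)}"
    obtain x y where xy: "z = (x, y)" by (rule prod.exhaust)
    with z eq[OF mem, of y] have "x \<noteq> int m" by auto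
    with z xy sub show "z \<in> {0..<int m} \<times> {0..<int d}" by auto
  qed
  moreover have "y < int e" if "(int m - 1, y) \<in> S" for y
    using less[OF that] mem by simp
  ultimately show ?thesis
    using eq less by (auto simp: profiles_def)
qed

text \<open>Profiles are split by whether the last column attains its maximal height
  \<open>e\<close>. If not, the bound drops to \<open>e\<close>; if so, removing that point costs a
  factor \<open>monom 1 1\<close> and passes the bound \<open>e\<close> on to the previous
  column.\<close>

lemma profile_poly_Suc_Suc:
  assumes "e < d"
  shows "profile_poly d (Suc m) (Suc e) = profile_poly d (Suc m) e + monom 1 1 * profile_poly d m e"
proof -
  let ?p = "(int m, int e)"
  let ?with = "{S \<in> profiles d (Suc m) (Suc e). ?p \<in> S}"
  have split: "profiles d (Suc m) (Suc e) = profiles d (Suc m) e \<union> ?with"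
  proof (intro equalityI subsetI)
    fix S assume S: "S \<in> profiles d (Suc m) (Suc e)"
    show "S \<in> profiles d (Suc m) e \<union> ?with"
    proof (cases "?p \<in> S")
      case False
      have "y < int e" if "(int m, y) \<in> S" for y
      proof -
        have "y < int (Suc e)" using S that by (simp add: profiles_def)
        moreover have "y \<noteq> int e" using False that by blast
        ultimately show ?thesis by simp
      qed
      with S show ?thesis by (simp add: profiles_def)
    qed (use S in simp)
  next
    fix S assume "S \<in> profiles d (Suc m) e \<union> ?with"
    moreover have "profiles d (Suc m) e \<subseteq> profiles d (Suc m) (Suc e)"
      by (auto simp: profiles_def simp del: split_paired_All)
    ultimately show "S \<in> profiles d (Suc m) (Suc e)" by blast
  qed
  have disj: "profiles d (Suc m) e \<inter> ?with = {}"
    by (auto simp: profiles_def)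
  have notin: "?p \<notin> S" if "S \<in> profiles d m e" for S
    using that by (auto simp: profiles_def)
  have "(\<Sum>S\<in>?with. monom 1 1 ^ card S) = (\<Sum>S\<in>profiles d m e. monom (1::int) 1 * monom 1 1 ^ card S)"
  proof (rule sum.reindex_bij_witness[where i = "insert ?p" and j = "\<lambda>S. S - {?p}"])
    fix S assume S: "S \<in> ?with"
    then have "card S = Suc (card (S - {?p}))"
      using card.remove[OF finite_profile, of S d "Suc m" "Suc e" ?p] by simp
    then show "monom 1 1 * monom 1 1 ^ card (S - {?p}) = monom (1::int) 1 ^ card S"
      by simp
  qed (use assms notin insert_in_profiles remove_from_profiles in auto)
  then show ?thesis
    unfolding profile_poly_def
    by (subst split, subst sum.union_disjoint)
      (use finite_profiles disj in \<open>auto simp: sum_distrib_left\<close>)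
qed

text \<open>Unrolling the recursion in \<open>e\<close>, each of the \<open>e\<close> steps either
  keeps \<open>m\<close> or lowers it by one with a factor \<open>monom 1 1\<close>; the binomial
  coefficient counts the ways to lower it \<open>k\<close> times.\<close>

lemma profile_poly_eq_sum_binomial:
  assumes h: "1 \<le> h" "1 \<le> d" "d \<le> h" and "e \<le> d"
  shows "profile_poly d m e =
    (\<Sum>k\<le>e. of_nat (e choose k) * monom 1 1 ^ k * tiling_poly h d (int m - int k))"
  using \<open>e \<le> d\<close>
proof (induction e arbitrary: m)
  case 0
  \<comment> \<open>With the last column empty, \<open>profile_poly d m 0\<close> is the tiling
    polynomial for \<open>m\<close> columns, whereas the bound \<open>d\<close> gives the one for
    \<open>m + 1\<close> columns.\<close>
  then show ?case
    using tiling_poly_Suc[OF h]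
    by (cases m) (simp_all del: of_nat_Suc add: profile_poly_no_columns profile_poly_empty_last tiling_poly_0)
next
  case (Suc e)
  let ?X = "monom 1 1 :: int poly" and ?P = "tiling_poly h d"
  show ?case
  proof (cases m)
    case 0
    \<comment> \<open>Only the term \<open>k = 0\<close> survives: all others have a negative index
      and vanish by convention.\<close>
    then show ?thesis
      by (simp add: profile_poly_no_columns tiling_poly_0 tiling_poly_neg sum.atMost_Suc_shift
          del: sum.atMost_Suc)
  next
    case (Suc n)
    let ?f = "\<lambda>k. of_nat (e choose k) * ?X ^ k * ?P (int m - int k)"
    \<comment> \<open>The added term vanishes since \<open>e choose Suc e = 0\<close>; it aligns the
      two sums for Pascal's rule once \<open>k = 0\<close> is split off.\<close>
    have "(\<Sum>k\<le>e. ?f k) = (\<Sum>k\<le>Suc e. ?f k)"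
      by simp
    also have "\<dots> = ?P (int m) + (\<Sum>k\<le>e. ?f (Suc k))"
      by (simp add: sum.atMost_Suc_shift del: sum.atMost_Suc)
    finally have shift: "(\<Sum>k\<le>e. ?f k) = ?P (int m) + (\<Sum>k\<le>e. ?f (Suc k))" .
    have "profile_poly d m (Suc e) = (\<Sum>k\<le>e. ?f k) +
        ?X * (\<Sum>k\<le>e. of_nat (e choose k) * ?X ^ k * ?P (int n - int k))"
      using Suc.prems Suc.IH[of m] Suc.IH[of n] profile_poly_Suc_Suc[of e d n] Suc by simp
    also have "\<dots> = ?P (int m) + (\<Sum>k\<le>e. ?f (Suc k) +
        of_nat (e choose k) * ?X ^ Suc k * ?P (int m - int (Suc k)))"
      unfolding shift using Suc by (simp add: sum.distrib sum_distrib_left mult_ac)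
    also have "\<dots> = ?P (int m) +
        (\<Sum>k\<le>e. of_nat (Suc e choose Suc k) * ?X ^ Suc k * ?P (int m - int (Suc k)))"
      by (simp add: algebra_simps)
    also have "\<dots> = (\<Sum>k\<le>Suc e. of_nat (Suc e choose k) * ?X ^ k * ?P (int m - int k))"
      by (simp add: sum.atMost_Suc_shift del: sum.atMost_Suc binomial_Suc_Suc)
    finally show ?thesis .
  qed
qed

theorem theorem2p5:
  fixes h d :: nat
  assumes "1 \<le> h" and "1 \<le> d" and "d \<le> h"
  shows "tiling_poly h d 0 = 1 \<and>
    (\<forall>n::nat. tiling_poly h d (int n + 1) =
       (\<Sum>k=0..d. of_nat (d choose k) * monom 1 1 ^ k * tiling_poly h d (int n - int k))) \<and>
    (\<forall>h'\<ge>d. \<forall>m::int. tiling_poly h' d m = tiling_poly h d m)"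
proof (intro conjI allI impI)
  show "tiling_poly h d 0 = 1"
    by (rule tiling_poly_0)
next
  fix n :: nat
  show "tiling_poly h d (int n + 1) =
      (\<Sum>k=0..d. of_nat (d choose k) * monom 1 1 ^ k * tiling_poly h d (int n - int k))"
    \<comment> \<open>\<open>profile_poly d n d\<close> is evaluated in two ways: as the polynomial
      for \<open>n + 1\<close> columns and by the binomial expansion at
      \<open>e = d\<close>.\<close>
    using tiling_poly_Suc[OF assms, of n] profile_poly_eq_sum_binomial[OF assms order_refl, of n]
    by (simp add: atMost_atLeast0 add.commute)
next
  fix h' :: nat and m :: int
  assume "d \<le> h'"
  then have h': "1 \<le> h'" using assms by simp
  consider "m < 0" | "m = 0" | n where "m = int (Suc n)"
    by (metis int_cases3 less_imp_Suc_add of_nat_0_less_iff zero_less_imp_eq_int not_less_iff_gr_or_eq)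
  \<comment> \<open>For positive \<open>m\<close> both sides equal
    \<open>profile_poly d n d\<close>, in which no tile height occurs.\<close>
  then show "tiling_poly h' d m = tiling_poly h d m"
    by cases (simp_all only: tiling_poly_neg tiling_poly_0 tiling_poly_Suc[OF assms]
        tiling_poly_Suc[OF h' assms(2) \<open>d \<le> h'\<close>])
qed

end
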